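(* Let $h:\mathbb{R}^n\to\overline{\mathbb{R}}$ be a proper function with convex domain, and let $\overline{x}\in\arg\min_{\mathbb{R}^n}h$. Assume that $h$ is $(\kappa,\gamma)$-strongly quasar-convex with respect to $\overline{x}$, where $\kappa\in(0,1]$ and $\gamma>0$, and that $h$ is locally Lipschitz on $\mathrm{dom}(h)$. Then $h$ satisfies the Polyak–Łojasiewicz property with modulus $\mu:=\gamma\kappa^2>0$, i.e. $$\frac12\,\mathrm{dist}^2(0,\partial^Ch(x))\ge\mu\,(h(x)-h(\overline{x})),\qquad\forall\,x\in\mathrm{dom}(h).$$
   Context: $\overline{\mathbb{R}}=\mathbb{R}\cup\{+\infty\}$; $\mathrm{dom}(h)=\{x:h(x)<+\infty\}$; $h$ is proper if $\mathrm{dom}(h)\neq\emptyset$; $\|\cdot\|$ is the Euclidean norm; $\mathrm{dist}(0,S)=\inf_{v\in S}\|v\|$. Locally Lipschitz on $\mathrm{dom}(h)$ means that every $x\in\mathrm{dom}(h)$ has an open neighborhood in $\mathbb{R}^n$ on which $h$ is (finite and) Lipschitz. Let $\kappa\in(0,1]$, $\gamma\ge 0$. A proper function $h:\mathbb{R}^n\to\overline{\mathbb{R}}$ with convex domain and $\arg\min_{\mathbb{R}^n}h\neq\emptyset$ is called $(\kappa,\gamma)$-strongly quasar-convex with respect to $\overline{x}\in\arg\min_{\mathbb{R}^n}h$ if for all $x\in\mathrm{dom}(h)$ and all $\lambda\in[0,1]$, $$h(\lambda\overline{x}+(1-\lambda)x)\le\kappa\lambda h(\overline{x})+(1-\kappa\lambda)h(x)-\lambda\left(1-\frac{\lambda}{2-\kappa}\right)\frac{\kappa\gamma}{2}\|x-\overline{x}\|^2.$$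 The Clarke directional derivative is $h^\circ(x;d)=\limsup_{y\to x,\,t\downarrow 0}\frac{h(y+td)-h(y)}{t}$, and the Clarke subdifferential is $\partial^Ch(x)=\{v\in\mathbb{R}^n:\langle v,d\rangle\le h^\circ(x;d)\ \forall d\in\mathbb{R}^n\}$ for $x\in\mathrm{dom}(h)$, and $\partial^Ch(x)=\emptyset$ otherwise. *)

theory Defs
  imports "HOL-Analysis.Analysis"
begin

definition eff_dom :: "('a \<Rightarrow> ereal) \<Rightarrow> 'a set" where
  "eff_dom h = {x. h x < \<infinity>}"

(* Functions into the reals extended by plus infinity only are modelled with values in ereal;
   the first conjunct excludes the value minus infinity. *)
definition proper_fun :: "('a \<Rightarrow> ereal) \<Rightarrow> bool" where
  "proper_fun h \<longleftrightarrow> (\<forall>x. h x \<noteq> -\<infinity>) \<and> eff_dom h \<noteq> {}"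

definition argmin_set :: "('a \<Rightarrow> ereal) \<Rightarrow> 'a set" where
  "argmin_set h = {x. is_arg_min h (\<lambda>_. True) x}"

definition strongly_quasar_convex ::
    "real \<Rightarrow> real \<Rightarrow> ('a::euclidean_space \<Rightarrow> ereal) \<Rightarrow> 'a \<Rightarrow> bool" where
  "strongly_quasar_convex \<kappa> \<gamma> h xbar \<longleftrightarrow>
     0 < \<kappa> \<and> \<kappa> \<le> 1 \<and> 0 \<le> \<gamma> \<and>
     proper_fun h \<and> convex (eff_dom h) \<and> xbar \<in> argmin_set h \<and>
     (\<forall>x\<in>eff_dom h. \<forall>s\<in>{0..1}.
        h (s *\<^sub>R xbar + (1 - s) *\<^sub>R x)
        \<le> ereal (\<kappa> * s) * h xbar + ereal (1 - \<kappa> * s) * h x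
            - ereal (s * (1 - s / (2 - \<kappa>)) * (\<kappa> * \<gamma> / 2) * (norm (x - xbar))\<^sup>2))"

(* The finiteness clause is needed because real_of_ereal maps infinite values to 0. *)
definition locally_lipschitz_on_dom :: "('a::euclidean_space \<Rightarrow> ereal) \<Rightarrow> bool" where
  "locally_lipschitz_on_dom h \<longleftrightarrow>
     (\<forall>x\<in>eff_dom h. \<exists>U. open U \<and> x \<in> U \<and> (\<forall>y\<in>U. \<bar>h y\<bar> \<noteq> \<infinity>) \<and>
        (\<exists>L. L-lipschitz_on U (\<lambda>y. real_of_ereal (h y))))"

(* As usual for the Clarke derivative, y = x is allowed in the upper limit,
   hence nhds x and not at x. *)
definition clarke_dir_deriv :: "('a::euclidean_space \<Rightarrow> ereal) \<Rightarrow> 'a \<Rightarrow> 'a \<Rightarrow> ereal" where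
  "clarke_dir_deriv h x d =
     Limsup (nhds x \<times>\<^sub>F at_right (0::real)) (\<lambda>(y, t). (h (y + t *\<^sub>R d) - h y) / ereal t)"

definition clarke_subdiff :: "('a::euclidean_space \<Rightarrow> ereal) \<Rightarrow> 'a \<Rightarrow> 'a set" where
  "clarke_subdiff h x =
     (if x \<in> eff_dom h then {v. \<forall>d. ereal (v \<bullet> d) \<le> clarke_dir_deriv h x d} else {})"

(* Unlike infdist and setdist, this is plus infinity (not 0) for the empty set. *)
definition dist_zero :: "'a::euclidean_space set \<Rightarrow> ereal" where
  "dist_zero S = (INF v\<in>S. ereal (norm v))"

end

theory Submission
  imports Defs
begin

text \<open>
  The inequality comes from testing a Clarke subgradient \<open>v\<close> at \<open>x\<close> against the single direction
  \<open>xbar - x\<close>. Quasar-convexity at a point \<open>y\<close> near \<open>x\<close> bounds the difference quotient of \<open>h\<close> at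
  \<open>y\<close> in the direction \<open>xbar - y\<close>; replacing that direction by \<open>xbar - x\<close> costs at most
  \<open>L * norm (y - x)\<close>, where \<open>L\<close> is a local Lipschitz constant. In the limit
  \<open>y \<rightarrow> x\<close>, \<open>t \<down> 0\<close> the cost vanishes, so the Clarke derivative satisfies
  (\<open>clarke_dir_deriv_quasar_le\<close>)
  \<open>h\<degree>(x; xbar - x) \<le> - \<kappa> (h x - h xbar) - (\<kappa> \<gamma> / 2) \<parallel>x - xbar\<parallel>\<^sup>2\<close>.
  By Cauchy-Schwarz every Clarke subgradient \<open>v\<close> therefore satisfies, with \<open>r = \<parallel>x - xbar\<parallel>\<close>,
  \<open>\<kappa> (h x - h xbar) + (\<kappa> \<gamma> / 2) r\<^sup>2 \<le> \<parallel>v\<parallel> r\<close>, and the arithmetic-geometric mean inequality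
  removes \<open>r\<close> and leaves \<open>2 \<gamma> \<kappa>\<^sup>2 (h x - h xbar) \<le> \<parallel>v\<parallel>\<^sup>2\<close>.
\<close>

lemma argmin_le:
  assumes "xbar \<in> argmin_set h"
  shows "h xbar \<le> h x"
  using assms by (auto simp: argmin_set_def is_arg_min_def not_less)

lemma finite_on_eff_dom:
  assumes "proper_fun h" "x \<in> eff_dom h"
  shows "\<bar>h x\<bar> \<noteq> \<infinity>"
  using assms by (auto simp: proper_fun_def eff_dom_def)

lemma finite_at_argmin:
  assumes "proper_fun h" "xbar \<in> argmin_set h"
  shows "\<bar>h xbar\<bar> \<noteq> \<infinity>"
proof -
  obtain x0 where "h x0 < \<infinity>"
    using assms(1) by (auto simp: proper_fun_def eff_dom_def)
  then have "h xbar < \<infinity>"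
    using argmin_le[OF assms(2), of x0] by (rule order.strict_trans1[rotated])
  then show ?thesis
    using assms(1) by (auto simp: proper_fun_def)
qed

lemma strongly_quasar_convex_real:
  assumes sqc: "strongly_quasar_convex \<kappa> \<gamma> h xbar"
    and y: "\<bar>h y\<bar> \<noteq> \<infinity>" and s: "0 \<le> s" "s \<le> 1"
    and z: "\<bar>h (y + s *\<^sub>R (xbar - y))\<bar> \<noteq> \<infinity>"
  shows "real_of_ereal (h (y + s *\<^sub>R (xbar - y))) - real_of_ereal (h y)
    \<le> s * (\<kappa> * (real_of_ereal (h xbar) - real_of_ereal (h y))
        - (1 - s / (2 - \<kappa>)) * (\<kappa> * \<gamma> / 2) * (norm (y - xbar))\<^sup>2)"
proof -
  have eq: "s *\<^sub>R xbar + (1 - s) *\<^sub>R y = y + s *\<^sub>R (xbar - y)"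
    by (simp add: algebra_simps)
  have xb: "\<bar>h xbar\<bar> \<noteq> \<infinity>"
    using sqc unfolding strongly_quasar_convex_def by (intro finite_at_argmin) blast+
  have "y \<in> eff_dom h"
    using y by (auto simp: eff_dom_def)
  then have "h (y + s *\<^sub>R (xbar - y))
        \<le> ereal (\<kappa> * s) * h xbar + ereal (1 - \<kappa> * s) * h y
            - ereal (s * (1 - s / (2 - \<kappa>)) * (\<kappa> * \<gamma> / 2) * (norm (y - xbar))\<^sup>2)"
    using sqc s unfolding strongly_quasar_convex_def eq[symmetric] by auto
  moreover obtain a b c where "h xbar = ereal a" "h y = ereal b"
      "h (y + s *\<^sub>R (xbar - y)) = ereal c"
    using xb y z by (metis ereal_real)
  ultimately have "c \<le> \<kappa> * s * a + (1 - \<kappa> * s) * b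
      - s * (1 - s / (2 - \<kappa>)) * (\<kappa> * \<gamma> / 2) * (norm (y - xbar))\<^sup>2"
    by simp
  then show ?thesis
    unfolding \<open>h xbar = _\<close> \<open>h y = _\<close> \<open>h (y + _) = _\<close> by (simp add: algebra_simps)
qed

lemma clarke_dir_deriv_quasar_le:
  fixes h :: "'a::euclidean_space \<Rightarrow> ereal"
  assumes sqc: "strongly_quasar_convex \<kappa> \<gamma> h xbar"
    and lip: "locally_lipschitz_on_dom h" and x: "x \<in> eff_dom h"
  shows "clarke_dir_deriv h x (xbar - x)
    \<le> ereal (\<kappa> * (real_of_ereal (h xbar) - real_of_ereal (h x))
        - (\<kappa> * \<gamma> / 2) * (norm (x - xbar))\<^sup>2)"
proof -
  define f where "f y = real_of_ereal (h y)" for y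
  obtain U L where U: "open U" "x \<in> U" and fin: "\<And>y. y \<in> U \<Longrightarrow> \<bar>h y\<bar> \<noteq> \<infinity>"
    and L: "L-lipschitz_on U f"
    using lip x unfolding locally_lipschitz_on_dom_def f_def by metis
  have hf: "h y = ereal (f y)" if "y \<in> U" for y
    using fin[OF that] by (simp add: f_def ereal_real)
  let ?F = "nhds x \<times>\<^sub>F at_right (0::real)"
  define g where "g = (\<lambda>(y, t). L * norm (y - x) + (\<kappa> * (f xbar - f y)
        - (1 - t / (2 - \<kappa>)) * (\<kappa> * \<gamma> / 2) * (norm (y - xbar))\<^sup>2))"
  have fst: "(fst \<longlongrightarrow> x) ?F"
    by (rule filterlim_fst)
  have snd: "(snd \<longlongrightarrow> 0) ?F"
    using filterlim_snd[of "at_right (0::real)" "nhds x"]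
    by (auto simp: filterlim_at)
  have "isCont f x"
    using lipschitz_on_continuous_on[OF L] U continuous_on_eq_continuous_at by blast
  then have cont: "((\<lambda>p. f (fst p)) \<longlongrightarrow> f x) ?F"
    using fst by (rule isCont_tendsto_compose)
  have k2: "2 - \<kappa> \<noteq> 0"
    using sqc by (auto simp: strongly_quasar_convex_def)
  have lim: "(g \<longlongrightarrow> \<kappa> * (f xbar - f x) - (\<kappa> * \<gamma> / 2) * (norm (x - xbar))\<^sup>2) ?F"
    unfolding g_def case_prod_beta
    by (rule tendsto_eq_intros fst snd cont k2 refl)+ simp
  have ev_pos: "\<forall>\<^sub>F p in ?F. 0 < snd p"
    using filterlim_snd[of "at_right (0::real)" "nhds x"]
    by (auto simp: filterlim_at elim: eventually_mono)
  have ev_1: "\<forall>\<^sub>F p in ?F. snd p < 1"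
    using order_tendstoD(2)[OF snd] by simp
  have ev_y: "\<forall>\<^sub>F p in ?F. fst p \<in> U"
    using topological_tendstoD[OF fst U] .
  have "((\<lambda>p. fst p + snd p *\<^sub>R (xbar - x)) \<longlongrightarrow> x) ?F"
    by (rule tendsto_eq_intros fst snd refl)+ simp
  then have ev_z: "\<forall>\<^sub>F p in ?F. fst p + snd p *\<^sub>R (xbar - x) \<in> U"
    using topological_tendstoD U by blast
  have "((\<lambda>p. fst p + snd p *\<^sub>R (xbar - fst p)) \<longlongrightarrow> x) ?F"
    by (rule tendsto_eq_intros fst snd refl)+ simp
  then have ev_w: "\<forall>\<^sub>F p in ?F. fst p + snd p *\<^sub>R (xbar - fst p) \<in> U"
    using topological_tendstoD U by blast
  have "\<forall>\<^sub>F p in ?F. (\<lambda>(y, t). (h (y + t *\<^sub>R (xbar - x)) - h y) / ereal t) p \<le> ereal (g p)"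
    using ev_pos ev_1 ev_y ev_z ev_w
  proof eventually_elim
    case (elim p)
    obtain y t where p: "p = (y, t)" by (cases p)
    define z where "z = y + t *\<^sub>R (xbar - x)"
    define w where "w = y + t *\<^sub>R (xbar - y)"
    have t: "0 < t" "t < 1" and U': "y \<in> U" "z \<in> U" "w \<in> U"
      using elim by (auto simp: p z_def w_def)
    have zw: "z - w = t *\<^sub>R (y - x)"
      by (simp add: z_def w_def algebra_simps)
    have "f z - f w \<le> L * norm (z - w)"
      using lipschitz_onD[OF L U'(2,3)] by (auto simp: dist_norm)
    then have "f z - f w \<le> t * (L * norm (y - x))"
      using t by (simp add: zw mult.left_commute)
    moreover have "f w - f y \<le> t * (\<kappa> * (f xbar - f y)
        - (1 - t / (2 - \<kappa>)) * (\<kappa> * \<gamma> / 2) * (norm (y - xbar))\<^sup>2)"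
      using strongly_quasar_convex_real[OF sqc, of y t] t fin[OF U'(1)] fin[OF U'(3)]
      by (simp add: f_def w_def)
    ultimately have "f z - f y \<le> t * g p"
      by (simp add: g_def p distrib_left)
    then have "(f z - f y) / t \<le> g p"
      using t by (simp add: divide_le_eq mult.commute)
    then show ?case
      using t by (simp add: p z_def[symmetric] hf[OF U'(1)] hf[OF U'(2)])
  qed
  then have "clarke_dir_deriv h x (xbar - x) \<le> Limsup ?F (\<lambda>p. ereal (g p))"
    unfolding clarke_dir_deriv_def by (rule Limsup_mono)
  also have "\<dots> = ereal (\<kappa> * (f xbar - f x) - (\<kappa> * \<gamma> / 2) * (norm (x - xbar))\<^sup>2)"
    using lim by (intro lim_imp_Limsup) (auto simp: prod_filter_eq_bot)
  finally show ?thesis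
    by (simp add: f_def)
qed

text \<open>The degenerate value \<open>r = 0\<close> forces \<open>D = 0\<close>, so no positivity of \<open>r\<close> is needed.\<close>

lemma square_bound_of_linear_bound:
  fixes \<kappa> \<gamma> D r n :: real
  assumes "0 < \<kappa>" "0 \<le> \<gamma>" "0 \<le> D" "0 \<le> r"
    and le: "\<kappa> * D + (\<kappa> * \<gamma> / 2) * r\<^sup>2 \<le> n * r"
  shows "2 * \<gamma> * \<kappa>\<^sup>2 * D \<le> n\<^sup>2"
proof (cases "r = 0")
  case True
  then have "D = 0"
    using assms by (simp add: mult_le_0_iff)
  then show ?thesis by simp
next
  case False
  have "2 * \<gamma> * \<kappa>\<^sup>2 * D * r\<^sup>2 \<le> (\<kappa> * D + (\<kappa> * \<gamma> / 2) * r\<^sup>2)\<^sup>2"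
    using zero_le_power2[of "\<kappa> * D - (\<kappa> * \<gamma> / 2) * r\<^sup>2"]
    by (simp add: power2_eq_square algebra_simps)
  also have "\<dots> \<le> (n * r)\<^sup>2"
    using assms by (intro power_mono) auto
  also have "\<dots> = n\<^sup>2 * r\<^sup>2"
    by (rule power_mult_distrib)
  finally show ?thesis
    using False by simp
qed

lemma clarke_subgradient_norm_ge:
  fixes h :: "'a::euclidean_space \<Rightarrow> ereal"
  assumes sqc: "strongly_quasar_convex \<kappa> \<gamma> h xbar"
    and lip: "locally_lipschitz_on_dom h" and x: "x \<in> eff_dom h"
    and v: "v \<in> clarke_subdiff h x"
  shows "2 * \<gamma> * \<kappa>\<^sup>2 * (real_of_ereal (h x) - real_of_ereal (h xbar)) \<le> (norm v)\<^sup>2"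
proof (rule square_bound_of_linear_bound[where r = "norm (x - xbar)"])
  have pr: "proper_fun h" "xbar \<in> argmin_set h"
    using sqc by (auto simp: strongly_quasar_convex_def)
  show "0 < \<kappa>" "0 \<le> \<gamma>" "0 \<le> norm (x - xbar)"
    using sqc by (auto simp: strongly_quasar_convex_def)
  show "0 \<le> real_of_ereal (h x) - real_of_ereal (h xbar)"
    using argmin_le[OF pr(2), of x] finite_on_eff_dom[OF pr(1) x] finite_at_argmin[OF pr]
    by (simp add: real_of_ereal_positive_mono real_le_ereal_iff ereal_real)
  have "ereal (v \<bullet> (xbar - x)) \<le> clarke_dir_deriv h x (xbar - x)"
    using v x by (auto simp: clarke_subdiff_def)
  also note clarke_dir_deriv_quasar_le[OF sqc lip x]
  finally have "v \<bullet> (xbar - x) \<le> \<kappa> * (real_of_ereal (h xbar) - real_of_ereal (h x))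
      - (\<kappa> * \<gamma> / 2) * (norm (x - xbar))\<^sup>2"
    by simp
  moreover have "- (v \<bullet> (xbar - x)) \<le> norm v * norm (x - xbar)"
    using norm_cauchy_schwarz[of v "x - xbar"] by (simp add: inner_diff_right)
  ultimately show "\<kappa> * (real_of_ereal (h x) - real_of_ereal (h xbar))
      + (\<kappa> * \<gamma> / 2) * (norm (x - xbar))\<^sup>2 \<le> norm v * norm (x - xbar)"
    by (simp add: algebra_simps)
qed

text \<open>The bound also holds for the empty set, whose distance to \<open>0\<close> is \<open>\<infinity>\<close>.\<close>

lemma dist_zero_square_ge:
  assumes "\<And>v. v \<in> S \<Longrightarrow> c \<le> (norm v)\<^sup>2" "0 \<le> c"
  shows "ereal c \<le> (dist_zero S)\<^sup>2"
proof -
  have "ereal (sqrt c) \<le> dist_zero S"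
    unfolding dist_zero_def using assms by (auto intro!: INF_greatest real_le_lsqrt)
  then have "ereal (sqrt c) * ereal (sqrt c) \<le> dist_zero S * dist_zero S"
    using assms(2) by (intro ereal_mult_mono) (auto intro: order_trans[rotated])
  then show ?thesis
    using assms(2) by (simp add: power2_eq_square)
qed

theorem proposition36:
  fixes h :: "real ^ 'n \<Rightarrow> ereal" and xbar :: "real ^ 'n" and \<kappa> \<gamma> :: real
  assumes "proper_fun h"
    and "convex (eff_dom h)"
    and "xbar \<in> argmin_set h"
    and "0 < \<kappa>" and "\<kappa> \<le> 1" and "0 < \<gamma>"
    and "strongly_quasar_convex \<kappa> \<gamma> h xbar"
    and "locally_lipschitz_on_dom h"
  shows "0 < \<gamma> * \<kappa>\<^sup>2 \<and>
    (\<forall>x\<in>eff_dom h.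
       ereal (1 / 2) * (dist_zero (clarke_subdiff h x))\<^sup>2 \<ge> ereal (\<gamma> * \<kappa>\<^sup>2) * (h x - h xbar))"
proof (intro conjI ballI)
  show "0 < \<gamma> * \<kappa>\<^sup>2"
    using assms by simp
next
  fix x assume x: "x \<in> eff_dom h"
  obtain a b where ab: "h x = ereal a" "h xbar = ereal b"
    using finite_on_eff_dom[OF assms(1) x] finite_at_argmin[OF assms(1,3)] by (metis ereal_real)
  have "b \<le> a"
    using argmin_le[OF assms(3), of x] by (simp add: ab)
  then have "ereal (2 * \<gamma> * \<kappa>\<^sup>2 * (a - b)) \<le> (dist_zero (clarke_subdiff h x))\<^sup>2"
    using clarke_subgradient_norm_ge[OF assms(7,8) x] assms(6)
    by (intro dist_zero_square_ge) (auto simp: ab)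
  then have "ereal (1 / 2) * ereal (2 * \<gamma> * \<kappa>\<^sup>2 * (a - b))
      \<le> ereal (1 / 2) * (dist_zero (clarke_subdiff h x))\<^sup>2"
    by (intro ereal_mult_left_mono) auto
  then show "ereal (\<gamma> * \<kappa>\<^sup>2) * (h x - h xbar)
      \<le> ereal (1 / 2) * (dist_zero (clarke_subdiff h x))\<^sup>2"
    by (simp add: ab mult.assoc)
qed

end
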